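(* Assume that the likelihood satisfies $g_y^{d_x}(x)\le m^{d_x}(x)\,q(y)$ for all $(x,y)\in\mathcal X\times\mathcal Y$, where $m^{d_x}:\mathcal X\to[0,\infty)$ and $q:\mathcal Y\to[0,\infty)$ are measurable functions with $\|m^{d_x}\|_\infty\le M(d_x)<\infty$ and $\|q\|_{L^1(\mathcal Y)}\le Q<\infty$ (where $M(d_x)$ may depend on $d_x$ and $Q$ does not). Then $$\mathbb E\big[\|\ell_Y^{\,d_x}\|_{L^2(\pi_0)}^2\big]\le M(d_x)\,Q<\infty,$$ so that $\ell^{\,d_x}\in L^2(\mathcal Y;L^2(\pi_0))$. Furthermore, for a family of such models indexed by $d_x\in\mathbb N$, if there is a constant $M$ with $M(d_x)\le M$ for all $d_x\in\mathbb N$, then $\sup_{d_x\in\mathbb N}\mathbb E\big[\|\ell_Y^{\,d_x}\|_{L^2(\pi_0)}^2\big]\le MQ<\infty$.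
   Context: $\mathcal X\subseteq\mathbb R^{d_x}$ and $\mathcal Y\subseteq\mathbb R^{d_y}$ are Borel sets; $\pi_0$ is a probability measure on $\mathcal X$. Given $X=x$, the observation $Y$ has density $g(y\mid x)$ w.r.t. Lebesgue measure on $\mathcal Y$. We write $g_y^{d_x}(x):=g(y\mid x)$; $g$ is jointly measurable, $g_y^{d_x}(x)>0$ for all $(x,y)$, $\int_{\mathcal Y}g_y^{d_x}(x)\,\mathrm dy=1$ for all $x$, and $g_y^{d_x}\in L^2(\pi_0)$ for all $y$. $L^1(\mathcal Y)$ is w.r.t. Lebesgue measure. $\pi_0(g_y^{d_x}):=\int g_y^{d_x}\,\mathrm d\pi_0$; the marginal law of $Y$ is $\eta(\mathrm dy)=\pi_0(g_y^{d_x})\,\mathrm dy$. The link function is $\ell^{\,d_x}:\mathcal Y\to L^2(\pi_0)$, $\ell_y^{\,d_x}:=g_y^{d_x}(\cdot)/\pi_0(g_y^{d_x})$, and $\mathbb E[\|\ell_Y^{\,d_x}\|_{L^2(\pi_0)}^2]=\int_{\mathcal Y}\|\ell_y^{\,d_x}\|_{L^2(\pi_0)}^2\,\eta(\mathrm dy)$. $L^2(\mathcal Y;L^2(\pi_0))$ is the Bochner space w.r.t. $\eta$. *)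

theory Defs
  imports "HOL-Probability.Probability"
begin

text \<open>
  The dimension \<open>d\<close> of the parameter space varies inside the statement, so the points of
  \<open>R^d\<close> are the extensional functions on \<open>{..<d}\<close>; the product sigma-algebra on them is the
  Borel sigma-algebra of \<open>R^d\<close>.  The observation space is a subset of \<open>real ^ 'n\<close>.
\<close>

abbreviation borel_Rn :: "nat \<Rightarrow> (nat \<Rightarrow> real) measure" where
  "borel_Rn d \<equiv> Pi\<^sub>M {..<d} (\<lambda>_. borel)"

abbreviation lebesgue_on_obs :: "(real ^ 'n) set \<Rightarrow> (real ^ 'n) measure" where
  "lebesgue_on_obs Y \<equiv> restrict_space lborel Y"

text \<open>
  Elements of \<open>L\<^sup>2(M)\<close> are handled through representatives; \<open>L2_norm M f\<close> is meaningful only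
  for \<open>f \<in> L2_space M\<close>.
\<close>

definition L2_space :: "'a measure \<Rightarrow> ('a \<Rightarrow> real) set" where
  "L2_space M = {f \<in> borel_measurable M. integrable M (\<lambda>x. (f x)\<^sup>2)}"

definition L2_norm :: "'a measure \<Rightarrow> ('a \<Rightarrow> real) \<Rightarrow> real" where
  "L2_norm M f = sqrt (\<integral>x. (f x)\<^sup>2 \<partial>M)"

text \<open>
  Strong measurability of an \<open>L\<^sup>2(M)\<close>-valued map with respect to \<open>N\<close>: almost everywhere limit,
  in the norm of \<open>L\<^sup>2(M)\<close>, of simple functions with values in \<open>L\<^sup>2(M)\<close>.  For the finite measures
  \<open>N\<close> considered here there is no need to ask that the simple functions have support of
  finite measure.
\<close>

definition strongly_measurable_L2 ::
    "'b measure \<Rightarrow> 'a measure \<Rightarrow> ('b \<Rightarrow> 'a \<Rightarrow> real) \<Rightarrow> bool" where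
  "strongly_measurable_L2 N M f \<longleftrightarrow>
     (\<exists>s :: nat \<Rightarrow> 'b \<Rightarrow> 'a \<Rightarrow> real.
        (\<forall>i. simple_function N (s i) \<and> (\<forall>y \<in> space N. s i y \<in> L2_space M)) \<and>
        (AE y in N. (\<lambda>i. L2_norm M (\<lambda>x. s i y x - f y x)) \<longlonglongrightarrow> 0))"

text \<open>The Bochner space \<open>L\<^sup>2(N; L\<^sup>2(M))\<close>.\<close>

definition Bochner_L2_L2 :: "'b measure \<Rightarrow> 'a measure \<Rightarrow> ('b \<Rightarrow> 'a \<Rightarrow> real) set" where
  "Bochner_L2_L2 N M =
     {f. (\<forall>y \<in> space N. f y \<in> L2_space M) \<and>
         strongly_measurable_L2 N M f \<and>
         (\<integral>\<^sup>+ y. ennreal ((L2_norm M (f y))\<^sup>2) \<partial>N) < \<infinity>}"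

text \<open>The likelihood is written \<open>g y x\<close> for \<open>g(y | x)\<close>.\<close>

locale likelihood_model =
  fixes d :: nat
    and X :: "(nat \<Rightarrow> real) set"
    and Y :: "(real ^ 'n) set"
    and \<pi> :: "(nat \<Rightarrow> real) measure"
    and g :: "real ^ 'n \<Rightarrow> (nat \<Rightarrow> real) \<Rightarrow> real"
  assumes X_borel: "X \<in> sets (borel_Rn d)"
    and Y_borel: "Y \<in> sets borel"
    and prior_prob: "prob_space \<pi>"
    and prior_sets: "sets \<pi> = sets (restrict_space (borel_Rn d) X)"
    and g_measurable: "(\<lambda>(x, y). g y x) \<in> borel_measurable (\<pi> \<Otimes>\<^sub>M lebesgue_on_obs Y)"
    and g_pos: "\<And>x y. x \<in> X \<Longrightarrow> y \<in> Y \<Longrightarrow> g y x > 0"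
    and g_density: "\<And>x. x \<in> X \<Longrightarrow> has_bochner_integral (lebesgue_on_obs Y) (\<lambda>y. g y x) 1"
    and g_L2: "\<And>y. y \<in> Y \<Longrightarrow> g y \<in> L2_space \<pi>"

definition evidence ::
    "(nat \<Rightarrow> real) measure \<Rightarrow> (real ^ 'n \<Rightarrow> (nat \<Rightarrow> real) \<Rightarrow> real) \<Rightarrow> real ^ 'n \<Rightarrow> real" where
  "evidence \<pi> g y = (\<integral>x. g y x \<partial>\<pi>)"

definition marginal_law ::
    "(real ^ 'n) set \<Rightarrow> (nat \<Rightarrow> real) measure \<Rightarrow> (real ^ 'n \<Rightarrow> (nat \<Rightarrow> real) \<Rightarrow> real) \<Rightarrow>
     (real ^ 'n) measure" where
  "marginal_law Y \<pi> g = density (lebesgue_on_obs Y) (\<lambda>y. ennreal (evidence \<pi> g y))"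

definition link ::
    "(nat \<Rightarrow> real) measure \<Rightarrow> (real ^ 'n \<Rightarrow> (nat \<Rightarrow> real) \<Rightarrow> real) \<Rightarrow>
     real ^ 'n \<Rightarrow> (nat \<Rightarrow> real) \<Rightarrow> real" where
  "link \<pi> g y = (\<lambda>x. g y x / evidence \<pi> g y)"

text \<open>The expectation is extended-valued, so that an upper bound on it includes its finiteness.\<close>

definition expected_link_norm2 ::
    "(real ^ 'n) set \<Rightarrow> (nat \<Rightarrow> real) measure \<Rightarrow> (real ^ 'n \<Rightarrow> (nat \<Rightarrow> real) \<Rightarrow> real) \<Rightarrow> ennreal" where
  "expected_link_norm2 Y \<pi> g =
     (\<integral>\<^sup>+ y. ennreal ((L2_norm \<pi> (link \<pi> g y))\<^sup>2) \<partial>marginal_law Y \<pi> g)"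

text \<open>
  The sup norm of \<open>m\<close> is read as the norm of \<open>L\<^sup>\<infinity>(\<pi>)\<close>; it is bounded by the pointwise supremum
  over \<open>X\<close>.
\<close>

locale dominated_model = likelihood_model d X Y \<pi> g
  for d :: nat
    and X :: "(nat \<Rightarrow> real) set"
    and Y :: "(real ^ 'n) set"
    and \<pi> :: "(nat \<Rightarrow> real) measure"
    and g :: "real ^ 'n \<Rightarrow> (nat \<Rightarrow> real) \<Rightarrow> real" +
  fixes m :: "(nat \<Rightarrow> real) \<Rightarrow> real"
    and q :: "real ^ 'n \<Rightarrow> real"
    and M :: real
    and Q :: real
  assumes m_measurable: "m \<in> borel_measurable \<pi>"
    and q_measurable: "q \<in> borel_measurable (lebesgue_on_obs Y)"
    and m_nonneg: "\<And>x. x \<in> X \<Longrightarrow> m x \<ge> 0"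
    and q_nonneg: "\<And>y. y \<in> Y \<Longrightarrow> q y \<ge> 0"
    and g_le: "\<And>x y. x \<in> X \<Longrightarrow> y \<in> Y \<Longrightarrow> g y x \<le> m x * q y"
    and m_bound: "esssup \<pi> (\<lambda>x. ereal \<bar>m x\<bar>) \<le> ereal M"
    and q_integrable: "integrable (lebesgue_on_obs Y) q"
    and q_bound: "(\<integral>y. \<bar>q y\<bar> \<partial>lebesgue_on_obs Y) \<le> Q"

end

theory Submission
  imports Defs
begin

text \<open>
  Writing the expectation as an integral over \<open>Y\<close>, one evidence factor cancels and leaves
  \<open>\<integral> (\<integral> g\<^sub>y\<^sup>2 d\<pi>) / \<pi>(g\<^sub>y) dy\<close>; since \<open>g\<^sub>y\<^sup>2 \<le> M q(y) g\<^sub>y\<close> holds \<open>\<pi>\<close>-almost everywhere, the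
  integrand is at most \<open>M q(y)\<close>.

  Strong measurability of the link function rests on joint measurability alone.  The jointly
  measurable functions whose square-integrable sections lie in the \<open>L\<^sup>2\<close>-closure of one countable
  set contain the indicators of rectangles and are closed under the operations of the monotone
  class argument, so every jointly measurable nonnegative function is of this kind.  Mapping \<open>y\<close>
  to the best approximation of its section among the first \<open>i\<close> elements of the countable set then
  gives the required simple functions.
\<close>

subsection \<open>Square-integrable functions\<close>

lemma L2_spaceI:
  assumes "f \<in> borel_measurable M" "integrable M (\<lambda>x. (f x)\<^sup>2)"
  shows "f \<in> L2_space M"
  using assms by (simp add: L2_space_def)

lemma L2_space_measurable: "f \<in> L2_space M \<Longrightarrow> f \<in> borel_measurable M"
  by (simp add: L2_space_def)

lemma L2_space_integrable_square: "f \<in> L2_space M \<Longrightarrow> integrable M (\<lambda>x. (f x)\<^sup>2)"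
  by (simp add: L2_space_def)

lemma L2_space_cong:
  assumes "\<And>x. x \<in> space M \<Longrightarrow> f x = g x"
  shows "f \<in> L2_space M \<longleftrightarrow> g \<in> L2_space M"
proof -
  have "f \<in> borel_measurable M \<longleftrightarrow> g \<in> borel_measurable M"
    using assms by (intro measurable_cong)
  moreover have "integrable M (\<lambda>x. (f x)\<^sup>2) \<longleftrightarrow> integrable M (\<lambda>x. (g x)\<^sup>2)"
    using assms by (intro Bochner_Integration.integrable_cong) auto
  ultimately show ?thesis
    by (simp add: L2_space_def)
qed

lemma L2_space_bound:
  assumes "g \<in> L2_space M" "f \<in> borel_measurable M" "\<And>x. x \<in> space M \<Longrightarrow> \<bar>f x\<bar> \<le> \<bar>g x\<bar>"
  shows "f \<in> L2_space M"
proof (rule L2_spaceI[OF assms(2)])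
  show "integrable M (\<lambda>x. (f x)\<^sup>2)"
    using L2_space_measurable[OF assms(1)] assms(2,3)
    by (intro Bochner_Integration.integrable_bound[OF L2_space_integrable_square[OF assms(1)]])
       (auto simp: abs_le_square_iff)
qed

lemma L2_space_cmult:
  assumes "f \<in> L2_space M"
  shows "(\<lambda>x. c * f x) \<in> L2_space M"
  using assms by (auto simp: L2_space_def power_mult_distrib)

text \<open>A rearrangement of \<open>(a - b)\<^sup>2 \<ge> 0\<close>. Distances are kept squared,
  and this replaces the triangle inequality at the price of a factor 2.\<close>

lemma square_add_le: "(a + b)\<^sup>2 \<le> 2 * a\<^sup>2 + 2 * (b::real)\<^sup>2"
  using zero_le_power2[of "a - b"] by (simp add: power2_eq_square algebra_simps)

lemma L2_space_add:
  assumes "f \<in> L2_space M" "g \<in> L2_space M"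
  shows "(\<lambda>x. f x + g x) \<in> L2_space M"
proof (rule L2_spaceI)
  note [measurable] = assms[THEN L2_space_measurable]
  show "(\<lambda>x. f x + g x) \<in> borel_measurable M"
    by measurable
  show "integrable M (\<lambda>x. (f x + g x)\<^sup>2)"
  proof (rule Bochner_Integration.integrable_bound)
    show "integrable M (\<lambda>x. 2 * (f x)\<^sup>2 + 2 * (g x)\<^sup>2)"
      using assms[THEN L2_space_integrable_square] by simp
    show "AE x in M. norm ((f x + g x)\<^sup>2) \<le> norm (2 * (f x)\<^sup>2 + 2 * (g x)\<^sup>2)"
      by (intro AE_I2) (simp add: square_add_le)
  qed measurable
qed

lemma L2_space_diff:
  assumes "f \<in> L2_space M" "g \<in> L2_space M"
  shows "(\<lambda>x. f x - g x) \<in> L2_space M"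
  using L2_space_add[OF assms(1) L2_space_cmult[OF assms(2), of "-1"]] by simp

lemma (in finite_measure) L2_space_indicator:
  assumes "A \<in> sets M"
  shows "indicator A \<in> L2_space M"
proof (rule L2_spaceI)
  show "integrable M (\<lambda>x. (indicator A x :: real)\<^sup>2)"
    using assms by (intro integrable_const_bound[where B=1]) (auto simp: indicator_def)
qed (use assms in simp)

text \<open>Triangle inequality for squared distances. Two errors below \<open>e / 4\<close> add up
  to less than \<open>e\<close>, which explains the tolerances chosen later.\<close>

lemma L2_dist_add_le:
  assumes "u \<in> L2_space M" "v \<in> L2_space M"
  shows "(\<integral>x. (u x + v x)\<^sup>2 \<partial>M) \<le> 2 * (\<integral>x. (u x)\<^sup>2 \<partial>M) + 2 * (\<integral>x. (v x)\<^sup>2 \<partial>M)"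
proof -
  note * = assms[THEN L2_space_integrable_square]
  have "(\<integral>x. (u x + v x)\<^sup>2 \<partial>M) \<le> (\<integral>x. 2 * (u x)\<^sup>2 + 2 * (v x)\<^sup>2 \<partial>M)"
    using L2_space_integrable_square[OF L2_space_add[OF assms]] * square_add_le
    by (intro integral_mono) auto
  also have "\<dots> = 2 * (\<integral>x. (u x)\<^sup>2 \<partial>M) + 2 * (\<integral>x. (v x)\<^sup>2 \<partial>M)"
    using * by simp
  finally show ?thesis .
qed

text \<open>From \<open>0 \<le> U i \<le> u\<close> follows \<open>0 \<le> u - U i \<le> u\<close>,
  so \<open>u\<^sup>2\<close> dominates the squared differences.\<close>

lemma L2_dominated_convergence:
  assumes u: "u \<in> L2_space M"
    and U: "\<And>i. U i \<in> borel_measurable M"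
    and bounds: "\<And>i x. x \<in> space M \<Longrightarrow> 0 \<le> U i x" "\<And>i x. x \<in> space M \<Longrightarrow> U i x \<le> u x"
    and lim: "\<And>x. x \<in> space M \<Longrightarrow> (\<lambda>i. U i x) \<longlonglongrightarrow> u x"
  shows "(\<lambda>i. \<integral>x. (u x - U i x)\<^sup>2 \<partial>M) \<longlonglongrightarrow> 0"
proof -
  note [measurable] = L2_space_measurable[OF u] U
  have "(\<lambda>i. \<integral>x. (u x - U i x)\<^sup>2 \<partial>M) \<longlonglongrightarrow> (\<integral>x. 0 \<partial>M)"
  proof (rule integral_dominated_convergence[where w="\<lambda>x. (u x)\<^sup>2"])
    show "AE x in M. (\<lambda>i. (u x - U i x)\<^sup>2) \<longlonglongrightarrow> 0"
    proof (rule AE_I2)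
      fix x assume "x \<in> space M"
      then have "(\<lambda>i. (u x - U i x)\<^sup>2) \<longlonglongrightarrow> (u x - u x)\<^sup>2"
        by (intro tendsto_intros lim)
      then show "(\<lambda>i. (u x - U i x)\<^sup>2) \<longlonglongrightarrow> 0"
        by simp
    qed
    show "AE x in M. norm ((u x - U i x)\<^sup>2) \<le> (u x)\<^sup>2" for i
      using bounds by (intro AE_I2) (auto intro!: power_mono)
  qed (use L2_space_integrable_square[OF u] in auto)
  then show ?thesis
    by simp
qed

subsection \<open>Separability of the range\<close>

text \<open>
  Sections outside \<open>L\<^sup>2\<close> are ignored, which makes the notion stable under monotone limits.
\<close>

definition L2_separably_valued :: "'b set \<Rightarrow> 'a measure \<Rightarrow> ('b \<Rightarrow> 'a \<Rightarrow> real) \<Rightarrow> bool" where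
  "L2_separably_valued S M f \<longleftrightarrow>
     (\<exists>D. countable D \<and> D \<subseteq> L2_space M \<and>
        (\<forall>y\<in>S. f y \<in> L2_space M \<longrightarrow> (\<forall>e>0. \<exists>h\<in>D. (\<integral>x. (f y x - h x)\<^sup>2 \<partial>M) < e)))"

lemma L2_separably_valuedI:
  assumes "countable D" "D \<subseteq> L2_space M"
    and "\<And>y e. y \<in> S \<Longrightarrow> f y \<in> L2_space M \<Longrightarrow> e > 0 \<Longrightarrow> \<exists>h\<in>D. (\<integral>x. (f y x - h x)\<^sup>2 \<partial>M) < e"
  shows "L2_separably_valued S M f"
  unfolding L2_separably_valued_def using assms by blast

lemma L2_separably_valuedE:
  assumes "L2_separably_valued S M f"
  obtains D where "countable D" "D \<subseteq> L2_space M"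
    "\<And>y e. y \<in> S \<Longrightarrow> f y \<in> L2_space M \<Longrightarrow> e > 0 \<Longrightarrow> \<exists>h\<in>D. (\<integral>x. (f y x - h x)\<^sup>2 \<partial>M) < e"
  using assms unfolding L2_separably_valued_def by blast

lemma L2_separably_valued_cong:
  assumes f: "L2_separably_valued S M f"
    and eq: "\<And>y x. y \<in> S \<Longrightarrow> x \<in> space M \<Longrightarrow> f y x = g y x"
  shows "L2_separably_valued S M g"
proof -
  from f obtain D where D: "countable D" "D \<subseteq> L2_space M"
    "\<And>y e. y \<in> S \<Longrightarrow> f y \<in> L2_space M \<Longrightarrow> e > 0 \<Longrightarrow> \<exists>h\<in>D. (\<integral>x. (f y x - h x)\<^sup>2 \<partial>M) < e"
    by (rule L2_separably_valuedE) blast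
  show ?thesis
  proof (rule L2_separably_valuedI[OF D(1,2)])
    fix y and e :: real assume y: "y \<in> S" "g y \<in> L2_space M" "e > 0"
    have "(\<integral>x. (g y x - h x)\<^sup>2 \<partial>M) = (\<integral>x. (f y x - h x)\<^sup>2 \<partial>M)" for h
      using eq[OF y(1)] by (intro Bochner_Integration.integral_cong) auto
    then show "\<exists>h\<in>D. (\<integral>x. (g y x - h x)\<^sup>2 \<partial>M) < e"
      using D(3)[OF y(1) _ y(3)] L2_space_cong[of M "f y" "g y", OF eq[OF y(1)]] y(2) by simp
  qed
qed

text \<open>The range itself, cut down to \<open>L2_space M\<close>, is the approximating set. This
  is the base case of the closure arguments below.\<close>

lemma L2_separably_valued_finite_range:
  assumes "finite (f ` S)"
  shows "L2_separably_valued S M f"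
proof (rule L2_separably_valuedI[where D="f ` S \<inter> L2_space M"])
  fix y and e :: real assume "y \<in> S" "f y \<in> L2_space M" "e > 0"
  then show "\<exists>h\<in>f ` S \<inter> L2_space M. (\<integral>x. (f y x - h x)\<^sup>2 \<partial>M) < e"
    by (intro bexI[of _ "f y"]) auto
qed (use assms in \<open>auto intro: countable_finite\<close>)

lemma L2_separably_valued_cmult:
  assumes "L2_separably_valued S M f"
  shows "L2_separably_valued S M (\<lambda>y x. c * f y x)"
\<comment> \<open>For \<open>c = 0\<close> the scaled section is always square integrable and
  reveals nothing about \<open>f y\<close>; but then the range is a single function.\<close>
proof (cases "c = 0")
  case True
  then show ?thesis
    by (intro L2_separably_valued_finite_range) (auto intro: finite_subset[of _ "{\<lambda>_. 0}"])
next
  case False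
  from assms obtain D where D: "countable D" "D \<subseteq> L2_space M"
    "\<And>y e. y \<in> S \<Longrightarrow> f y \<in> L2_space M \<Longrightarrow> e > 0 \<Longrightarrow> \<exists>h\<in>D. (\<integral>x. (f y x - h x)\<^sup>2 \<partial>M) < e"
    by (rule L2_separably_valuedE) blast
  show ?thesis
  proof (rule L2_separably_valuedI[where D="(\<lambda>h x. c * h x) ` D"])
    show "(\<lambda>h x. c * h x) ` D \<subseteq> L2_space M"
      using D(2) L2_space_cmult by blast
    fix y and e :: real assume y: "y \<in> S" "(\<lambda>x. c * f y x) \<in> L2_space M" "e > 0"
    have "f y \<in> L2_space M"
      using L2_space_cmult[OF y(2), of "1 / c"] False by simp
    \<comment> \<open>Scaling multiplies squared distances by \<open>c\<^sup>2\<close>, hence the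
      tolerance \<open>e / c\<^sup>2\<close>.\<close>
    then obtain h where h: "h \<in> D" "(\<integral>x. (f y x - h x)\<^sup>2 \<partial>M) < e / c\<^sup>2"
      using D(3)[OF y(1), of "e / c\<^sup>2"] y(3) False by auto
    have "(\<integral>x. (c * f y x - c * h x)\<^sup>2 \<partial>M) = c\<^sup>2 * (\<integral>x. (f y x - h x)\<^sup>2 \<partial>M)"
      by (simp add: power_mult_distrib flip: right_diff_distrib)
    also have "\<dots> < e"
      using h(2) False by (simp add: field_simps)
    finally show "\<exists>h\<in>(\<lambda>h x. c * h x) ` D. (\<integral>x. (c * f y x - h x)\<^sup>2 \<partial>M) < e"
      using h(1) by auto
  qed (use D(1) in simp)
qed

text \<open>Sums of approximants approximate the sum. Hypothesis \<open>L2\<close> excludes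
  cancellation: a sum can be square integrable although its summands are not, and then the two given
  sets provide no approximants.\<close>

lemma L2_separably_valued_add:
  assumes f: "L2_separably_valued S M f" and g: "L2_separably_valued S M g"
    and L2: "\<And>y. y \<in> S \<Longrightarrow> (\<lambda>x. f y x + g y x) \<in> L2_space M \<Longrightarrow>
               f y \<in> L2_space M \<and> g y \<in> L2_space M"
  shows "L2_separably_valued S M (\<lambda>y x. f y x + g y x)"
proof -
  from f obtain D where D: "countable D" "D \<subseteq> L2_space M"
    "\<And>y e. y \<in> S \<Longrightarrow> f y \<in> L2_space M \<Longrightarrow> e > 0 \<Longrightarrow> \<exists>h\<in>D. (\<integral>x. (f y x - h x)\<^sup>2 \<partial>M) < e"
    by (rule L2_separably_valuedE) blast
  from g obtain E where E: "countable E" "E \<subseteq> L2_space M"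
    "\<And>y e. y \<in> S \<Longrightarrow> g y \<in> L2_space M \<Longrightarrow> e > 0 \<Longrightarrow> \<exists>h\<in>E. (\<integral>x. (g y x - h x)\<^sup>2 \<partial>M) < e"
    by (rule L2_separably_valuedE) blast
  show ?thesis
  proof (rule L2_separably_valuedI[where D="(\<lambda>(h, k) x. h x + k x) ` (D \<times> E)"])
    show "(\<lambda>(h, k) x. h x + k x) ` (D \<times> E) \<subseteq> L2_space M"
      using D(2) E(2) L2_space_add by fastforce
    fix y and e :: real assume y: "y \<in> S" "(\<lambda>x. f y x + g y x) \<in> L2_space M" "e > 0"
    note fg = L2[OF y(1,2), THEN conjunct1] L2[OF y(1,2), THEN conjunct2]
    obtain h where h: "h \<in> D" "(\<integral>x. (f y x - h x)\<^sup>2 \<partial>M) < e / 4"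
      using D(3)[OF y(1) fg(1), of "e / 4"] y(3) by auto
    obtain k where k: "k \<in> E" "(\<integral>x. (g y x - k x)\<^sup>2 \<partial>M) < e / 4"
      using E(3)[OF y(1) fg(2), of "e / 4"] y(3) by auto
    have "(\<integral>x. (f y x + g y x - (h x + k x))\<^sup>2 \<partial>M) = (\<integral>x. ((f y x - h x) + (g y x - k x))\<^sup>2 \<partial>M)"
      by (simp add: algebra_simps)
    also have "\<dots> \<le> 2 * (\<integral>x. (f y x - h x)\<^sup>2 \<partial>M) + 2 * (\<integral>x. (g y x - k x)\<^sup>2 \<partial>M)"
      using h(1) k(1) D(2) E(2) fg by (intro L2_dist_add_le L2_space_diff) auto
    also have "\<dots> < e"
      using h(2) k(2) by simp
    finally show "\<exists>h\<in>(\<lambda>(h, k) x. h x + k x) ` (D \<times> E). (\<integral>x. (f y x + g y x - h x)\<^sup>2 \<partial>M) < e"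
      using h(1) k(1) by (auto intro!: bexI[of _ "(h, k)"])
  qed (use D(1) E(1) in simp)
qed

text \<open>The union of the countable sets works: where the limit section is in L2, domination puts
  all \<open>U i y\<close> in L2, and dominated convergence makes one of them close.\<close>

lemma L2_separably_valued_lim:
  assumes U: "\<And>i::nat. L2_separably_valued S M (U i)"
    and meas: "\<And>i y. y \<in> S \<Longrightarrow> U i y \<in> borel_measurable M"
    and bounds: "\<And>i y x. y \<in> S \<Longrightarrow> x \<in> space M \<Longrightarrow> 0 \<le> U i y x"
      "\<And>i y x. y \<in> S \<Longrightarrow> x \<in> space M \<Longrightarrow> U i y x \<le> u y x"
    and lim: "\<And>y x. y \<in> S \<Longrightarrow> x \<in> space M \<Longrightarrow> (\<lambda>i. U i y x) \<longlonglongrightarrow> u y x"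
  shows "L2_separably_valued S M u"
proof -
  have "\<exists>D. countable D \<and> D \<subseteq> L2_space M \<and>
      (\<forall>y\<in>S. U i y \<in> L2_space M \<longrightarrow> (\<forall>e>0. \<exists>h\<in>D. (\<integral>x. (U i y x - h x)\<^sup>2 \<partial>M) < e))" for i
    using U[of i] unfolding L2_separably_valued_def .
  then obtain D where D: "\<And>i. countable (D i)" "\<And>i. D i \<subseteq> L2_space M"
    "\<And>i y e. y \<in> S \<Longrightarrow> U i y \<in> L2_space M \<Longrightarrow> e > 0 \<Longrightarrow>
       \<exists>h\<in>D i. (\<integral>x. (U i y x - h x)\<^sup>2 \<partial>M) < e"
    by metis
  show ?thesis
  proof (rule L2_separably_valuedI[where D="\<Union>i. D i"])
    fix y and e :: real assume y: "y \<in> S" "u y \<in> L2_space M" "e > 0"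
    have U_L2: "U i y \<in> L2_space M" for i
    proof (rule L2_space_bound[OF y(2) meas[OF y(1)]])
      fix x assume x: "x \<in> space M"
      show "\<bar>U i y x\<bar> \<le> \<bar>u y x\<bar>"
        using bounds(1)[OF y(1) x, of i] bounds(2)[OF y(1) x, of i] by linarith
    qed
    have "(\<lambda>i. \<integral>x. (u y x - U i y x)\<^sup>2 \<partial>M) \<longlonglongrightarrow> 0"
      using y(1) by (intro L2_dominated_convergence y(2) meas bounds lim) auto
    then have "\<forall>\<^sub>F i in sequentially. (\<integral>x. (u y x - U i y x)\<^sup>2 \<partial>M) < e / 4"
      using y(3) by (intro order_tendstoD(2)) auto
    \<comment> \<open>This index depends on \<open>y\<close> and \<open>e\<close>, which is harmless
      because the union contains every \<open>D i\<close>.\<close>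
    then obtain i where i: "(\<integral>x. (u y x - U i y x)\<^sup>2 \<partial>M) < e / 4"
      by (auto simp: eventually_sequentially)
    obtain h where h: "h \<in> D i" "(\<integral>x. (U i y x - h x)\<^sup>2 \<partial>M) < e / 4"
      using D(3)[OF y(1) U_L2, of "e / 4" i] y(3) by auto
    have "(\<integral>x. (u y x - h x)\<^sup>2 \<partial>M) = (\<integral>x. ((u y x - U i y x) + (U i y x - h x))\<^sup>2 \<partial>M)"
      by simp
    also have "\<dots> \<le> 2 * (\<integral>x. (u y x - U i y x)\<^sup>2 \<partial>M) + 2 * (\<integral>x. (U i y x - h x)\<^sup>2 \<partial>M)"
      using h(1) D(2)[of i] y(2) U_L2 by (intro L2_dist_add_le L2_space_diff) auto
    also have "\<dots> < e"
      using i h(2) by simp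
    finally show "\<exists>h\<in>\<Union>i. D i. (\<integral>x. (u y x - h x)\<^sup>2 \<partial>M) < e"
      using h(1) by blast
  qed (use D(1,2) in auto)
qed

text \<open>Induction over the sigma-algebra generated by the rectangles, an intersection-stable
  family. A rectangle has at most two distinct sections; complements and disjoint unions reduce to
  sums, multiples and limits.\<close>

lemma (in finite_measure) L2_separably_valued_indicator:
  assumes "A \<in> sets (N \<Otimes>\<^sub>M M)"
  shows "L2_separably_valued (space N) M (\<lambda>y x. indicator A (y, x))"
proof -
  have section_L2: "(\<lambda>x. indicator A (y, x)) \<in> L2_space M"
    if "y \<in> space N" "A \<in> sets (N \<Otimes>\<^sub>M M)" for y A
  proof -
    have "(\<lambda>x. indicator A (y, x)) = indicator (Pair y -` A)"
      by (auto simp: indicator_def)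
    then show ?thesis
      using L2_space_indicator[OF sets_Pair1[OF that(2), of y]] by metis
  qed
  have "A \<in> sigma_sets (space N \<times> space M) {a \<times> b |a b. a \<in> sets N \<and> b \<in> sets M}"
    using assms by (simp add: sets_pair_measure)
  with Int_stable_pair_measure_generator pair_measure_closed show ?thesis
  proof (induction rule: sigma_sets_induct_disjoint)
    case (basic A)
    then obtain a b where "A = a \<times> b"
      by blast
    then have "(\<lambda>y x. indicator A (y, x)) ` space N \<subseteq> {(\<lambda>_. 0 :: real), indicator b}"
      by (auto simp: indicator_def fun_eq_iff)
    then show ?case
      by (intro L2_separably_valued_finite_range) (auto intro: finite_subset)
  next
    case empty
    then show ?case
      by (intro L2_separably_valued_finite_range) (auto intro: finite_subset[of _ "{\<lambda>_. 0}"])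
  next
    case (compl A)
    have A: "A \<in> sets (N \<Otimes>\<^sub>M M)"
      using compl.hyps by (simp add: sets_pair_measure)
    have 1: "(\<lambda>x. 1) \<in> L2_space M"
      by (auto intro: L2_spaceI)
    \<comment> \<open>The indicator of the complement, written so that the closure under sums and
      multiples applies.\<close>
    have "L2_separably_valued (space N) M (\<lambda>y x. 1 + (-1) * indicator A (y, x))"
    proof (rule L2_separably_valued_add)
      show "L2_separably_valued (space N) M (\<lambda>y x. 1)"
        by (intro L2_separably_valued_finite_range) (auto intro: finite_subset[of _ "{\<lambda>_. 1}"])
      show "L2_separably_valued (space N) M (\<lambda>y x. (-1) * indicator A (y, x))"
        by (intro L2_separably_valued_cmult compl.IH)
    qed (use 1 section_L2[OF _ A] L2_space_cmult in blast)
    then show ?case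
      by (rule L2_separably_valued_cong) (auto simp: indicator_def)
  next
    case (union A)
    have A: "A i \<in> sets (N \<Otimes>\<^sub>M M)" for i
      using union.hyps(2) by (auto simp: sets_pair_measure)
    \<comment> \<open>Disjointness makes the indicator of a finite union additive, so the finite
      unions can be handled by induction on \<open>n\<close>.\<close>
    have sum_eq: "(\<Sum>i<n. indicator (A i) z) = (indicator (\<Union>i<n. A i) z :: real)" for n z
      using union.hyps(1)
      by (intro indicator_UN_disjoint[symmetric]) (auto simp: disjoint_family_on_def)
    have "L2_separably_valued (space N) M (\<lambda>y x. indicator (\<Union>i<n. A i) (y, x))" for n
    proof (induction n)
      case 0
      show ?case
        by (intro L2_separably_valued_finite_range) (auto intro: finite_subset[of _ "{\<lambda>_. 0}"])
    next
      case (Suc n)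
      have "L2_separably_valued (space N) M
              (\<lambda>y x. indicator (\<Union>i<n. A i) (y, x) + indicator (A n) (y, x))"
        by (rule L2_separably_valued_add[OF Suc union.IH]) (use A section_L2 in auto)
      then show ?case
        by (rule L2_separably_valued_cong) (simp flip: sum_eq)
    qed
    then show ?case
    proof (rule L2_separably_valued_lim)
      show "(\<lambda>x. indicator (\<Union>j<i. A j) (y, x) :: real) \<in> borel_measurable M"
        if "y \<in> space N" for i y
        using that A by (intro L2_space_measurable section_L2) auto
      show "(\<lambda>i. indicator (\<Union>j<i. A j) (y, x)) \<longlonglongrightarrow> (indicator (\<Union>j. A j) (y, x) :: real)" for y x
        by (rule LIMSEQ_indicator_UN)
    qed (auto simp: indicator_def)
  qed
qed

text \<open>Monotone class argument: nonnegative measurable functions arise from indicators by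
  nonnegative multiples, sums and increasing limits, and each operation has its closure lemma
  above.\<close>

lemma (in finite_measure) L2_separably_valued_nonneg:
  assumes f: "f \<in> borel_measurable (N \<Otimes>\<^sub>M M)"
    and nonneg: "\<And>z. 0 \<le> f z"
  shows "L2_separably_valued (space N) M (\<lambda>y x. f (y, x))"
  using f nonneg
proof (induction rule: borel_measurable_induct_real)
  case (set A)
  then show ?case
    by (rule L2_separably_valued_indicator)
next
  case (mult u c)
  then show ?case
    by (intro L2_separably_valued_cmult)
next
  case (add u v)
  note [measurable] = add.hyps(1,3)
  show ?case
  proof (rule L2_separably_valued_add[OF add.IH(2,1)])
    fix y assume y: "y \<in> space N" "(\<lambda>x. v (y, x) + u (y, x)) \<in> L2_space M"
    \<comment> \<open>Both summands are nonnegative, so each is dominated by the sum.\<close>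
    show "(\<lambda>x. v (y, x)) \<in> L2_space M \<and> (\<lambda>x. u (y, x)) \<in> L2_space M"
      using y(1) add.hyps by (intro conjI L2_space_bound[OF y(2)]) auto
  qed
next
  case (seq U)
  note [measurable] = seq.hyps(1)
  from seq.IH show ?case
  proof (rule L2_separably_valued_lim)
    fix i y x assume yx: "y \<in> space N" "x \<in> space M"
    then show lim: "(\<lambda>i. U i (y, x)) \<longlonglongrightarrow> f (y, x)"
      by (intro seq.hyps) (simp add: space_pair_measure)
    show "U i (y, x) \<le> f (y, x)"
      using seq.hyps(3) by (intro incseq_le[OF _ lim]) (auto simp: incseq_def le_fun_def)
  qed (use seq.hyps in auto)
qed

text \<open>A countable approximating set is enumerated, and \<open>y\<close> is sent to the nearest
  of its first elements. The choice takes finitely many values and depends measurably on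
  \<open>y\<close>, and its error tends to 0.\<close>

lemma (in finite_measure) strongly_measurable_L2_nonneg:
  assumes f[measurable]: "case_prod f \<in> borel_measurable (N \<Otimes>\<^sub>M M)"
    and nonneg: "\<And>y x. y \<in> space N \<Longrightarrow> x \<in> space M \<Longrightarrow> 0 \<le> f y x"
    and L2: "\<And>y. y \<in> space N \<Longrightarrow> f y \<in> L2_space M"
  shows "strongly_measurable_L2 N M f"
proof -
  \<comment> \<open>Nonnegativity is known only on the two spaces, whereas the induction asks for it
    everywhere; truncation changes nothing on the spaces.\<close>
  have "L2_separably_valued (space N) M (\<lambda>y x. max 0 (case_prod f (y, x)))"
    by (intro L2_separably_valued_nonneg) auto
  then have "L2_separably_valued (space N) M f"
    by (rule L2_separably_valued_cong) (use nonneg in auto)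
  then obtain D where D: "countable D" "D \<subseteq> L2_space M"
    "\<And>y e. y \<in> space N \<Longrightarrow> f y \<in> L2_space M \<Longrightarrow> e > 0 \<Longrightarrow> \<exists>h\<in>D. (\<integral>x. (f y x - h x)\<^sup>2 \<partial>M) < e"
    by (rule L2_separably_valuedE) blast
  \<comment> \<open>Adding the zero function makes the set nonempty, so that the enumeration has
    exactly this set as its range.\<close>
  define h where "h = from_nat_into (insert (\<lambda>_. 0) D)"
  have range_h: "range h = insert (\<lambda>_. 0) D"
    unfolding h_def using D(1) by (intro range_from_nat_into) auto
  have h_L2: "h k \<in> L2_space M" for k
  proof -
    have "(\<lambda>_. 0) \<in> L2_space M"
      by (auto intro: L2_spaceI)
    then show ?thesis
      using range_h D(2) by (metis insert_subset rangeI subsetD)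
  qed
  note [measurable] = h_L2[THEN L2_space_measurable]
  define dist2 where "dist2 y k = (\<integral>x. (f y x - h k x)\<^sup>2 \<partial>M)" for y k
  have [measurable]: "(\<lambda>y. dist2 y k) \<in> borel_measurable N" for k
    unfolding dist2_def by measurable
  \<comment> \<open>Among the indices \<open>0, ..., i\<close>, the smallest one with minimal
    distance; resolving ties by \<open>LEAST\<close> keeps the choice measurable.\<close>
  define best where "best i y = (LEAST k. k \<le> i \<and> (\<forall>j\<le>i. dist2 y k \<le> dist2 y j))" for i y
  have best: "best i y \<le> i \<and> (\<forall>j\<le>i. dist2 y (best i y) \<le> dist2 y j)" for i y
  proof -
    have "\<exists>k\<in>{..i}. \<forall>j\<in>{..i}. dist2 y k \<le> dist2 y j"
      using ex_is_arg_min_if_finite[of "{..i}" "dist2 y"]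
      by (auto simp: is_arg_min_linorder)
    then have "\<exists>k. k \<le> i \<and> (\<forall>j\<le>i. dist2 y k \<le> dist2 y j)"
      by auto
    from LeastI_ex[OF this] show ?thesis
      unfolding best_def .
  qed
  have "simple_function N (best i)" for i
    unfolding simple_function_eq_measurable
  proof
    show "finite (best i ` space N)"
      using best by (auto intro: finite_subset[of _ "{..i}"])
    show "best i \<in> N \<rightarrow>\<^sub>M count_space UNIV"
      unfolding best_def by measurable
  qed
  then have "simple_function N (\<lambda>y. h (best i y))" for i
    by (rule simple_function_compose1)
  moreover have "(\<lambda>i. L2_norm M (\<lambda>x. h (best i y) x - f y x)) \<longlonglongrightarrow> 0" if y: "y \<in> space N" for y
  proof -
    have "(\<lambda>i. dist2 y (best i y)) \<longlonglongrightarrow> 0"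
    proof (rule order_tendstoI)
      fix a :: real assume "a < 0"
      then have "a < dist2 y k" for k
        unfolding dist2_def by (rule less_le_trans) (rule integral_nonneg_AE, simp)
      then show "\<forall>\<^sub>F i in sequentially. a < dist2 y (best i y)"
        by simp
    next
      fix e :: real assume "0 < e"
      then obtain h' where h': "h' \<in> D" "(\<integral>x. (f y x - h' x)\<^sup>2 \<partial>M) < e"
        using D(3)[OF y L2[OF y]] by blast
      then have "h' \<in> range h"
        by (simp add: range_h)
      then obtain k where "h' = h k"
        by blast
      with h' have k: "dist2 y k < e"
        by (simp add: dist2_def)
      \<comment> \<open>From \<open>i = k\<close> on, the good index \<open>k\<close> is among the
        candidates, so the best one does at least as well.\<close>
      show "\<forall>\<^sub>F i in sequentially. dist2 y (best i y) < e"
        unfolding eventually_sequentially using best k by (meson le_less_trans)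
    qed
    then have "(\<lambda>i. sqrt (dist2 y (best i y))) \<longlonglongrightarrow> sqrt 0"
      by (rule tendsto_real_sqrt)
    then show ?thesis
      by (simp add: L2_norm_def dist2_def power2_commute)
  qed
  ultimately show ?thesis
    unfolding strongly_measurable_L2_def using h_L2
    by (intro exI[of _ "\<lambda>i y. h (best i y)"]) auto
qed

subsection \<open>The bound\<close>

lemma L2_norm_square: "(L2_norm M f)\<^sup>2 = (\<integral>x. (f x)\<^sup>2 \<partial>M)"
  unfolding L2_norm_def by simp

section \<open>Evidence, link function and strong measurability for a general likelihood\<close>

context likelihood_model
begin

lemma space_prior: "space \<pi> = X"
  using sets_eq_imp_space_eq[OF prior_sets] sets.sets_into_space[OF X_borel]
  by (auto simp: space_restrict_space)

lemma space_obs: "space (lebesgue_on_obs Y) = Y"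
  by (simp add: space_restrict_space)

lemma likelihood_measurable: "case_prod g \<in> borel_measurable (lebesgue_on_obs Y \<Otimes>\<^sub>M \<pi>)"
  using measurable_pair_swap[OF g_measurable] by (simp add: case_prod_unfold)

lemma evidence_measurable: "evidence \<pi> g \<in> borel_measurable (lebesgue_on_obs Y)"
proof -
  interpret prob_space \<pi> by (rule prior_prob)
  show ?thesis
    unfolding evidence_def[abs_def] using likelihood_measurable by measurable
qed

lemma evidence_nonneg: "y \<in> Y \<Longrightarrow> 0 \<le> evidence \<pi> g y"
  unfolding evidence_def using g_pos by (intro integral_nonneg_AE AE_I2) (auto simp: space_prior less_imp_le)

lemma link_measurable: "case_prod (link \<pi> g) \<in> borel_measurable (lebesgue_on_obs Y \<Otimes>\<^sub>M \<pi>)"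
  using evidence_measurable likelihood_measurable unfolding link_def case_prod_unfold by measurable

lemma link_nonneg: "y \<in> Y \<Longrightarrow> x \<in> X \<Longrightarrow> 0 \<le> link \<pi> g y x"
  unfolding link_def using evidence_nonneg g_pos by (simp add: less_imp_le)

lemma link_L2:
  assumes "y \<in> Y"
  shows "link \<pi> g y \<in> L2_space \<pi>"
  using L2_space_cmult[OF g_L2[OF assms], of "1 / evidence \<pi> g y"] by (simp add: link_def)

text \<open>Passing to Lebesgue measure exposes the density \<open>evidence \<pi> g y\<close>, which
  is to cancel one of the two evidence factors in the squared link norm.\<close>

lemma expected_link_norm2_eq:
  "expected_link_norm2 Y \<pi> g =
     (\<integral>\<^sup>+ y. ennreal (evidence \<pi> g y * (L2_norm \<pi> (link \<pi> g y))\<^sup>2) \<partial>lebesgue_on_obs Y)"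
proof -
  interpret prob_space \<pi> by (rule prior_prob)
  note [measurable] = evidence_measurable link_measurable
  have "(\<lambda>y. (L2_norm \<pi> (link \<pi> g y))\<^sup>2) \<in> borel_measurable (lebesgue_on_obs Y)"
    unfolding L2_norm_square by measurable
  then have "expected_link_norm2 Y \<pi> g =
     (\<integral>\<^sup>+ y. ennreal (evidence \<pi> g y) * ennreal ((L2_norm \<pi> (link \<pi> g y))\<^sup>2) \<partial>lebesgue_on_obs Y)"
    unfolding expected_link_norm2_def marginal_law_def by (subst nn_integral_density) auto
  also have "\<dots> = (\<integral>\<^sup>+ y. ennreal (evidence \<pi> g y * (L2_norm \<pi> (link \<pi> g y))\<^sup>2) \<partial>lebesgue_on_obs Y)"
    by (intro nn_integral_cong) (simp add: evidence_nonneg space_obs flip: ennreal_mult)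
  finally show ?thesis .
qed

text \<open>The marginal law has a density, so it keeps the sigma-algebra of Lebesgue measure on
  \<open>Y\<close>, and joint measurability carries over.\<close>

lemma strongly_measurable_link: "strongly_measurable_L2 (marginal_law Y \<pi> g) \<pi> (link \<pi> g)"
proof -
  interpret prob_space \<pi> by (rule prior_prob)
  have [measurable_cong]: "sets (marginal_law Y \<pi> g) = sets (lebesgue_on_obs Y)"
    and space: "space (marginal_law Y \<pi> g) = Y"
    by (simp_all add: marginal_law_def space_restrict_space)
  show ?thesis
  proof (rule strongly_measurable_L2_nonneg)
    show "case_prod (link \<pi> g) \<in> borel_measurable (marginal_law Y \<pi> g \<Otimes>\<^sub>M \<pi>)"
      using link_measurable by measurable
  qed (auto simp: space space_prior link_nonneg link_L2)
qed

end

section \<open>Consequences of the domination of the likelihood\<close>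

context dominated_model
begin

text \<open>An essential supremum bounds \<open>m\<close> only almost everywhere, so the later
  comparison of integrals is an almost-everywhere one.\<close>

lemma AE_m_le: "AE x in \<pi>. m x \<le> M"
proof -
  have "AE x in \<pi>. ereal \<bar>m x\<bar> \<le> esssup \<pi> (\<lambda>x. ereal \<bar>m x\<bar>)"
    by (rule esssup_AE)
  then show ?thesis
  proof eventually_elim
    case (elim x)
    then have "ereal \<bar>m x\<bar> \<le> ereal M"
      using m_bound by (rule order_trans)
    then show ?case
      by simp
  qed
qed

text \<open>Almost every \<open>x\<close> satisfies \<open>0 \<le> m x \<le> M\<close>, and under a
  probability measure a constant statement that holds almost everywhere is true.\<close>

lemma M_nonneg: "0 \<le> M"
proof -
  interpret prob_space \<pi> by (rule prior_prob)
  have "AE x in \<pi>. 0 \<le> M"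
    using AE_m_le AE_space by eventually_elim (use m_nonneg space_prior order_trans in blast)
  then show ?thesis
    by simp
qed

lemma Q_nonneg: "0 \<le> Q"
  using q_bound by (rule order_trans[rotated]) (simp add: integral_nonneg_AE)

text \<open>Only one factor of the square is estimated, by \<open>m x * q y \<le> M * q y\<close>;
  the other is kept and integrates to the evidence.\<close>

lemma integral_likelihood_square_le:
  assumes y: "y \<in> Y"
  shows "(\<integral>x. (g y x)\<^sup>2 \<partial>\<pi>) \<le> M * q y * evidence \<pi> g y"
proof -
  interpret prob_space \<pi> by (rule prior_prob)
  have g: "integrable \<pi> (g y)"
    using g_L2[OF y] by (auto simp: L2_space_def intro: square_integrable_imp_integrable)
  have "(\<integral>x. (g y x)\<^sup>2 \<partial>\<pi>) \<le> (\<integral>x. M * q y * g y x \<partial>\<pi>)"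
  proof (rule integral_mono_AE)
    show "AE x in \<pi>. (g y x)\<^sup>2 \<le> M * q y * g y x"
      using AE_m_le AE_space
    proof eventually_elim
      case (elim x)
      then have x: "x \<in> X"
        by (simp add: space_prior)
      have "g y x \<le> M * q y"
        using g_le[OF x y] mult_right_mono[OF elim(1) q_nonneg[OF y]] by linarith
      then show ?case
        using g_pos[OF x y] by (simp add: power2_eq_square mult_right_mono)
    qed
  qed (use g L2_space_integrable_square[OF g_L2[OF y]] in auto)
  also have "\<dots> = M * q y * evidence \<pi> g y"
    by (simp add: evidence_def)
  finally show ?thesis .
qed

lemma evidence_times_link_norm2_le:
  assumes y: "y \<in> Y"
  shows "evidence \<pi> g y * (L2_norm \<pi> (link \<pi> g y))\<^sup>2 \<le> M * q y"
proof (cases "evidence \<pi> g y = 0")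
  \<comment> \<open>Only nonnegativity of the evidence is at hand. At 0 the leading factor
    annihilates the left side, and the right side is nonnegative.\<close>
  case True
  then show ?thesis
    using M_nonneg q_nonneg[OF y] by simp
next
  case False
  then have pos: "0 < evidence \<pi> g y"
    using evidence_nonneg[OF y] by simp
  have "evidence \<pi> g y * (L2_norm \<pi> (link \<pi> g y))\<^sup>2 = (\<integral>x. (g y x)\<^sup>2 \<partial>\<pi>) / evidence \<pi> g y"
    using pos by (simp add: L2_norm_square link_def power_divide) (simp add: power2_eq_square)
  also have "\<dots> \<le> M * q y"
    using integral_likelihood_square_le[OF y] pos by (simp add: divide_le_eq)
  finally show ?thesis .
qed

lemma expected_link_norm2_le: "expected_link_norm2 Y \<pi> g \<le> ennreal (M * Q)"
proof -
  have "expected_link_norm2 Y \<pi> g \<le> (\<integral>\<^sup>+ y. ennreal (M * q y) \<partial>lebesgue_on_obs Y)"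
    unfolding expected_link_norm2_eq
    by (intro nn_integral_mono ennreal_leI evidence_times_link_norm2_le) (simp add: space_obs)
  \<comment> \<open>Back to a Bochner integral, the form in which \<open>q_bound\<close> is given;
    its absolute value is harmless as \<open>q\<close> is nonnegative on \<open>Y\<close>.\<close>
  also have "\<dots> = ennreal (\<integral>y. M * q y \<partial>lebesgue_on_obs Y)"
    using q_integrable M_nonneg q_nonneg space_obs by (intro nn_integral_eq_integral) auto
  also have "(\<integral>y. M * q y \<partial>lebesgue_on_obs Y) = M * (\<integral>y. \<bar>q y\<bar> \<partial>lebesgue_on_obs Y)"
    unfolding Bochner_Integration.integral_mult_right_zero
    using q_nonneg space_obs by (intro arg_cong[where f="\<lambda>t. M * t"] Bochner_Integration.integral_cong) auto
  also have "ennreal \<dots> \<le> ennreal (M * Q)"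
    using q_bound M_nonneg by (intro ennreal_leI mult_left_mono)
  finally show ?thesis .
qed

lemma link_Bochner_L2: "link \<pi> g \<in> Bochner_L2_L2 (marginal_law Y \<pi> g) \<pi>"
proof -
  have "space (marginal_law Y \<pi> g) = Y"
    by (simp add: marginal_law_def space_restrict_space)
  \<comment> \<open>This is the integral condition in \<open>Bochner_L2_L2\<close>, once the
    expectation is unfolded.\<close>
  moreover have "expected_link_norm2 Y \<pi> g < \<infinity>"
    using expected_link_norm2_le by (rule le_less_trans) simp
  ultimately show ?thesis
    unfolding Bochner_L2_L2_def expected_link_norm2_def
    using link_L2 strongly_measurable_link by simp
qed

end

theorem mainTheorem7:
  fixes Y :: "(real ^ 'n) set"
  shows
    "(\<forall>d X \<pi> g m q M Q.
        dominated_model d X Y \<pi> g m q M Q \<longrightarrow>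
          expected_link_norm2 Y \<pi> g \<le> ennreal (M * Q) \<and> ennreal (M * Q) < \<infinity> \<and>
          link \<pi> g \<in> Bochner_L2_L2 (marginal_law Y \<pi> g) \<pi>) \<and>
     (\<forall>X \<pi> g m q Md Q M.
        (\<forall>d\<ge>1. dominated_model d (X d) Y (\<pi> d) (g d) (m d) (q d) (Md d) Q \<and> Md d \<le> M) \<longrightarrow>
          (SUP d\<in>{1..}. expected_link_norm2 Y (\<pi> d) (g d)) \<le> ennreal (M * Q) \<and>
          ennreal (M * Q) < \<infinity>)"
proof (intro conjI allI impI)
  fix d X \<pi> g m q M Q
  assume "dominated_model d X Y \<pi> g m q M Q"
  then interpret dominated_model d X Y \<pi> g m q M Q .
  show "expected_link_norm2 Y \<pi> g \<le> ennreal (M * Q)"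
    by (rule expected_link_norm2_le)
  show "link \<pi> g \<in> Bochner_L2_L2 (marginal_law Y \<pi> g) \<pi>"
    by (rule link_Bochner_L2)
next
  fix X \<pi> g m q Md Q M
  assume *: "\<forall>d\<ge>1. dominated_model d (X d) Y (\<pi> d) (g d) (m d) (q d) (Md d) Q \<and> Md d \<le> M"
  show "(SUP d\<in>{1..}. expected_link_norm2 Y (\<pi> d) (g d)) \<le> ennreal (M * Q)"
  proof (rule SUP_least)
    fix d :: nat assume "d \<in> {1..}"
    with * interpret dominated_model d "X d" Y "\<pi> d" "g d" "m d" "q d" "Md d" Q
      by simp
    have "Md d \<le> M"
      using * \<open>d \<in> {1..}\<close> by simp
    \<comment> \<open>Enlarging \<open>Md d\<close> to \<open>M\<close> uses
      \<open>0 \<le> Q\<close>, which the model at this \<open>d\<close> supplies.\<close>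
    then have "ennreal (Md d * Q) \<le> ennreal (M * Q)"
      by (intro ennreal_leI mult_right_mono Q_nonneg)
    with expected_link_norm2_le show "expected_link_norm2 Y (\<pi> d) (g d) \<le> ennreal (M * Q)"
      by (rule order_trans)
  qed
qed simp_all

end
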